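(* Let $(f_n)_{n=1}^{\infty}$ be a sequence of maps from the interval $[0,a]$ to itself such that $f_n(0)=0$ for every $n$. Assume also that this sequence is either pinched or equiconcave. For a starting point $x_0\in[0,a]$ define inductively $x_n=f_n(x_{n-1})$ for $n\ge 1$, and similarly $y_n=f_n(y_{n-1})$ for a starting point $y_0$. Let $b_n$ be the isoclinic point of $f_n$. Then for every $x_0,y_0\in(0,a]$ such that $x_n,y_n<b_n$ for all $n$, we have $\lim_{n\to\infty}|x_n-y_n|=0$.
   Context: Here $a>0$. For $\alpha\ge 0$, a continuous real-valued function $f$ on a closed interval is $\alpha$-concave if the function $x\mapsto f(x)+\alpha x^2$ is concave. A sequence $(f_n)_{n=1}^\infty$ of maps from $[0,a]$ to itself with $f_n(0)=0$ for every $n$ is pinched if there exists $n$ such that $f_n$ is identically zero; it is equiconcave if there exists a constant $\beta>0$ such that each $f_n$ is $\beta\gamma_n$-concave, where $\gamma_n$ is the supremum of $f_n$. For a strictly concave nonnegative function $f$ on $[0,a]$ with $f(0)=0$ and left one-sided derivative $f'_-$, the isoclinic point of $f$ is $b=\sup\{x\in(0,a]: |f'_-(x)|<f(x)/x\}$; the isoclinic point of a monotone function is $a$.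
   Formalization: The condition "x_n, y_n < b_n for all n" is replaced by x_{n-1}, y_{n-1} < b_n for all n ≥ 1 (each input of f_n lies below the isoclinic point of f_n); as printed, the claim fails for a period-two sequence alternating t(1-t) with a suitable increasing map. *)

theory Defs
  imports "HOL-Analysis.Analysis"
begin

text \<open>A sequence \<open>f\<^sub>1, f\<^sub>2, \<dots>\<close> of maps of \<open>[0,a]\<close> is a function \<^typ>\<open>nat \<Rightarrow> real \<Rightarrow> real\<close>;
  the member with index \<open>0\<close> and all values outside \<open>[0,a]\<close> are irrelevant.\<close>

definition alpha_concave_on :: "real \<Rightarrow> real \<Rightarrow> real \<Rightarrow> (real \<Rightarrow> real) \<Rightarrow> bool" where
  "alpha_concave_on \<alpha> c d f \<longleftrightarrow>
     \<alpha> \<ge> 0 \<and> continuous_on {c..d} f \<and> concave_on {c..d} (\<lambda>x. f x + \<alpha> * x\<^sup>2)"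

definition pinched :: "real \<Rightarrow> (nat \<Rightarrow> real \<Rightarrow> real) \<Rightarrow> bool" where
  "pinched a f \<longleftrightarrow> (\<exists>n\<ge>1. \<forall>x\<in>{0..a}. f n x = 0)"

definition equiconcave :: "real \<Rightarrow> (nat \<Rightarrow> real \<Rightarrow> real) \<Rightarrow> bool" where
  "equiconcave a f \<longleftrightarrow>
     (\<exists>\<beta>>0. \<forall>n\<ge>1. alpha_concave_on (\<beta> * (SUP x\<in>{0..a}. f n x)) 0 a (f n))"

text \<open>The isoclinic point is meaningful for functions on \<open>[0,a]\<close> that are monotone, or that are
  nonnegative, strictly concave and vanish at \<open>0\<close>; if both apply, both prescriptions give \<open>a\<close>.
  The left derivative of a concave function exists and is finite on \<open>(0,a)\<close>, but it may be
  \<open>-\<infinity>\<close> at \<open>a\<close>, where the inequality then fails; hence the existential quantifier over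
  real \<open>D\<close>.\<close>

definition isoclinic_point :: "real \<Rightarrow> (real \<Rightarrow> real) \<Rightarrow> real" where
  "isoclinic_point a f =
     (if mono_on {0..a} f \<or> antimono_on {0..a} f then a
      else Sup {x \<in> {0<..a}. \<exists>D. (f has_real_derivative D) (at_left x) \<and> \<bar>D\<bar> < f x / x})"

end

theory Submission
  imports Defs
begin

text \<open>Let \<open>\<gamma>\<close> be the supremum of \<open>f\<close>. If \<open>f\<close> is \<open>\<beta>\<gamma>\<close>-concave and \<open>u < v\<close> lie left of its
  isoclinic point, then both \<open>f v / f u\<close> and \<open>f u / f v\<close> are at most \<open>v / u - \<beta> (v - u)\<^sup>2\<close>: the
  first bound because \<open>f t / t + \<beta>\<gamma> t\<close> is nonincreasing, the second because left of the isoclinic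
  point the slopes of \<open>f\<close> exceed \<open>- f t / t\<close>. Hence the quotient of the larger by the smaller of
  \<open>x\<^sub>n\<close> and \<open>y\<^sub>n\<close> decreases by at least \<open>\<beta> (x\<^sub>n - y\<^sub>n)\<^sup>2\<close> in each step; it is bounded below, so
  these decrements tend to \<open>0\<close>. If some \<open>f\<^sub>n\<close> vanishes, both orbits are eventually \<open>0\<close>.\<close>

section \<open>Secant slopes and left derivatives of \<alpha>-concave functions\<close>

lemma alpha_concave_on_three_points:
  assumes "alpha_concave_on \<alpha> c d f" "c \<le> u" "u < v" "v < w" "w \<le> d"
  shows "(w - v) * f u + (v - u) * f w + \<alpha> * ((w - u) * (w - v) * (v - u)) \<le> (w - u) * f v"
proof -
  define F where "F = (\<lambda>x. f x + \<alpha> * x\<^sup>2)"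
  define t where "t = (v - u) / (w - u)"
  have "concave_on {c..d} F"
    using assms(1) by (simp add: alpha_concave_on_def F_def)
  moreover have "0 \<le> t" "t \<le> 1"
    using assms by (auto simp: t_def)
  ultimately have "F ((1 - t) *\<^sub>R u + t *\<^sub>R w) \<ge> (1 - t) * F u + t * F w"
    using assms by (intro concave_onD) auto
  moreover have tw: "t * (w - u) = v - u"
    using assms by (simp add: t_def)
  moreover have "(1 - t) *\<^sub>R u + t *\<^sub>R w = v"
    using tw by (simp add: algebra_simps)
  ultimately have "(1 - t) * F u + t * F w \<le> F v"
    by simp
  then have "(w - u) * ((1 - t) * F u + t * F w) \<le> (w - u) * F v"
    using assms by (intro mult_left_mono) auto
  moreover have "(w - u) * ((1 - t) * F u + t * F w)
      = ((w - u) - t * (w - u)) * F u + (t * (w - u)) * F w"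
    by (simp add: algebra_simps)
  ultimately have "(w - v) * F u + (v - u) * F w \<le> (w - u) * F v"
    using tw by simp
  \<comment> \<open>The quadratic part contributes \<open>(w - v) * u\<^sup>2 + (v - u) * w\<^sup>2
    - (w - u) * v\<^sup>2\<close>, which factors as
    \<open>(w - u) * (w - v) * (v - u)\<close>.\<close>
  then show ?thesis
    by (simp add: F_def algebra_simps power2_eq_square)
qed

lemma secant_slope_antimono:
  assumes "alpha_concave_on \<alpha> c d f" "c \<le> u" "u < v" "v < w" "w \<le> d"
  shows "(f w - f v) / (w - v) \<le> (f w - f u) / (w - u) - \<alpha> * (v - u)"
proof -
  have "(w - u) * (f w - f v) \<le> (w - v) * (f w - f u) - \<alpha> * ((w - u) * (w - v) * (v - u))"
    using alpha_concave_on_three_points[OF assms] by (simp add: algebra_simps)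
  then show ?thesis
    using assms by (simp add: field_simps)
qed

text \<open>Slopes of secants ending at \<open>w\<close> are nonincreasing in the left endpoint and
  tend to \<open>D\<close>, so \<open>D\<close> lies below each of them.\<close>

lemma left_derivative_le_secant_slope:
  assumes "alpha_concave_on \<alpha> c d f" "c \<le> u" "u < w" "w \<le> d"
    and D: "(f has_real_derivative D) (at_left w)"
  shows "D * (w - u) \<le> f w - f u"
proof -
  have lim: "((\<lambda>s. (f s - f w) / (s - w)) \<longlongrightarrow> D) (at_left w)"
    using D by (simp add: has_field_derivative_iff)
  have "eventually (\<lambda>s. s \<in> {u<..<w}) (at_left w)"
    using \<open>u < w\<close> by (intro eventually_at_leftI) auto
  then have "eventually (\<lambda>s. (f s - f w) / (s - w) \<le> (f w - f u) / (w - u)) (at_left w)"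
  proof eventually_elim
    case (elim s)
    have "(f s - f w) / (s - w) = (f w - f s) / (w - s)"
      by (metis minus_diff_eq minus_divide_divide)
    moreover have "\<alpha> * (s - u) \<ge> 0"
      using assms elim by (simp add: alpha_concave_on_def)
    ultimately show ?case
      using secant_slope_antimono[OF assms(1,2), of s w] elim assms by auto
  qed
  from tendsto_upperbound[OF lim this] have "D \<le> (f w - f u) / (w - u)"
    by simp
  then show ?thesis
    using assms by (simp add: field_simps)
qed

text \<open>Supplies a finite left derivative even at \<open>t = d\<close>, where concavity alone
  would allow minus infinity. The slopes \<open>q s\<close> decrease as \<open>s\<close> approaches
  \<open>t\<close> and are bounded below by \<open>0\<close> because \<open>t\<close> is a maximum,
  so they converge to their infimum.\<close>

lemma left_derivative_at_maximum:
  assumes conc: "alpha_concave_on \<alpha> c d f" and t: "c < t" "t \<le> d"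
    and max: "\<And>s. s \<in> {c..d} \<Longrightarrow> f s \<le> f t"
  obtains D where "(f has_real_derivative D) (at_left t)" "0 \<le> D"
proof -
  define q where "q s = (f t - f s) / (t - s)" for s
  have \<alpha>: "\<alpha> \<ge> 0"
    using conc by (simp add: alpha_concave_on_def)
  have mono: "q s' \<le> q s" if "c \<le> s" "s < s'" "s' < t" for s s'
  proof -
    have "0 \<le> \<alpha> * (s' - s)"
      using that \<alpha> by simp
    then show ?thesis
      using secant_slope_antimono[OF conc that t(2)] unfolding q_def by linarith
  qed
  have nonneg: "0 \<le> q s" if "s \<in> {c..<t}" for s
    using that max[of s] t by (auto simp: q_def)
  define D where "D = (INF s\<in>{c..<t}. q s)"
  have bdd: "bdd_below (q ` {c..<t})"
    using nonneg by (intro bdd_belowI[of _ 0]) auto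
  have ev: "eventually (\<lambda>s. s \<in> {c'<..<t}) (at_left t)" if "c' < t" for c'
    using that by (intro eventually_at_leftI) auto
  have "(q \<longlongrightarrow> D) (at_left t)"
  proof (rule decreasing_tendsto)
    show "eventually (\<lambda>s. D \<le> q s) (at_left t)"
      using ev[OF t(1)] by eventually_elim (auto simp: D_def intro!: cINF_lower bdd)
  next
    fix e assume "D < e"
    then obtain r where r: "r \<in> {c..<t}" "q r < e"
      unfolding D_def using cINF_less_iff[OF _ bdd, of e] t(1) by auto
    then have "r < t"
      by simp
    from ev[OF this] show "eventually (\<lambda>s. q s < e) (at_left t)"
    proof eventually_elim
      case (elim s)
      then show ?case
        using mono[of r s] r by auto
    qed
  qed
  moreover have "q = (\<lambda>s. (f s - f t) / (s - t))"
    by (auto simp: q_def fun_eq_iff) (metis minus_diff_eq minus_divide_divide)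
  ultimately have "(f has_real_derivative D) (at_left t)"
    by (simp add: has_field_derivative_iff)
  moreover have "0 \<le> D"
    unfolding D_def using nonneg t(1) by (intro cINF_greatest) auto
  ultimately show ?thesis
    using that by blast
qed

text \<open>The secant from \<open>w / 2\<close> separates the two sides: its slope is at least
  \<open>D\<close>, and \<open>\<alpha> > 0\<close> makes it strictly smaller than the slope of the
  chord from \<open>0\<close>.\<close>

lemma left_derivative_below_chord:
  assumes conc: "alpha_concave_on \<alpha> 0 d f" and "\<alpha> > 0" "f 0 = 0" "0 < w" "w \<le> d"
    and D: "(f has_real_derivative D) (at_left w)"
  shows "D < f w / w"
proof -
  have "D * (w - w / 2) \<le> f w - f (w / 2)"
    by (rule left_derivative_le_secant_slope[OF conc _ _ _ D]) (use assms in auto)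
  then have "D \<le> (f w - f (w / 2)) / (w - w / 2)"
    using assms by (simp add: field_simps)
  also have "\<dots> \<le> (f w - f 0) / (w - 0) - \<alpha> * (w / 2 - 0)"
    by (rule secant_slope_antimono[OF conc]) (use assms in auto)
  also have "\<dots> < f w / w"
    using assms by simp
  finally show ?thesis .
qed

section \<open>Points left of the isoclinic point\<close>

lemma isoclinic_pointE:
  assumes conc: "alpha_concave_on \<alpha> 0 a f" and "\<alpha> > 0" "a > 0" "f 0 = 0"
    and pos: "\<And>x. x \<in> {0<..<a} \<Longrightarrow> f x > 0"
    and v: "v < isoclinic_point a f"
  obtains (mono) "mono_on {0..a} f" "v < a"
  | (steep) w D where "v < w" "0 < w" "w \<le> a" "(f has_real_derivative D) (at_left w)"
      "\<bar>D\<bar> < f w / w"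
proof (cases "mono_on {0..a} f")
  case True
  then show ?thesis
    using v mono by (simp add: isoclinic_point_def)
next
  case False
  have "\<not> antimono_on {0..a} f"
  proof
    assume "antimono_on {0..a} f"
    then have "f (a / 2) \<le> f 0"
      by (rule monotone_onD) (use \<open>a > 0\<close> in auto)
    then show False
      using pos[of "a / 2"] \<open>a > 0\<close> \<open>f 0 = 0\<close> by simp
  qed
  define S where
    "S = {x \<in> {0<..a}. \<exists>D. (f has_real_derivative D) (at_left x) \<and> \<bar>D\<bar> < f x / x}"
  have "v < Sup S"
    using v False \<open>\<not> antimono_on {0..a} f\<close> by (simp add: isoclinic_point_def S_def)
  \<comment> \<open>Only for nonempty \<open>S\<close> does \<open>v < Sup S\<close> yield an
    element beyond \<open>v\<close>. A maximum point of \<open>f\<close> serves as witness: there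
    \<open>0 \<le> D\<close> and \<open>D < f t / t\<close>.\<close>
  moreover have "S \<noteq> {}"
  proof -
    have "continuous_on {0..a} f"
      using conc by (simp add: alpha_concave_on_def)
    then obtain t where t: "t \<in> {0..a}" "\<And>s. s \<in> {0..a} \<Longrightarrow> f s \<le> f t"
      using continuous_attains_sup[of "{0..a}" f] \<open>a > 0\<close> by auto
    have "f (a / 2) \<le> f t"
      using t \<open>a > 0\<close> by auto
    then have "f t > 0"
      using pos[of "a / 2"] \<open>a > 0\<close> by auto
    then have "0 < t"
      using t \<open>f 0 = 0\<close> by (cases "t = 0") auto
    then obtain D where "(f has_real_derivative D) (at_left t)" "0 \<le> D"
      using left_derivative_at_maximum[OF conc, of t] t by auto
    moreover from this have "D < f t / t"
      using left_derivative_below_chord[OF conc] assms t \<open>0 < t\<close> by auto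
    ultimately have "t \<in> S"
      unfolding S_def using t \<open>0 < t\<close> by auto
    then show ?thesis by auto
  qed
  ultimately obtain w where "w \<in> S" "v < w"
    using less_cSupE by blast
  then show ?thesis
    using steep by (auto simp: S_def)
qed

section \<open>One-step bounds on the quotient of two values\<close>

lemma increasing_ratio_bound:
  assumes conc: "alpha_concave_on (\<beta> * \<gamma>) 0 d f" and "f 0 = 0" "\<beta> > 0"
    and uv: "0 < u" "u < v" "v \<le> d" and f: "0 < f u" "f u \<le> \<gamma>"
  shows "f v / f u \<le> v / u - \<beta> * (v - u)\<^sup>2"
proof -
  have "u * f v + \<beta> * \<gamma> * (v * (v - u) * u) \<le> v * f u"
    using alpha_concave_on_three_points[OF conc, of 0 u v] assms by simp
  \<comment> \<open>Using \<open>f u \<le> \<gamma>\<close> and \<open>v - u \<le> v\<close>, the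
    concavity gain is weakened so that division by \<open>u * f u\<close> leaves exactly the
    decrement \<open>\<beta> * (v - u)\<^sup>2\<close>.\<close>
  moreover have "f u * (\<beta> * (v - u)\<^sup>2 * u) \<le> \<gamma> * (\<beta> * (v * (v - u)) * u)"
    unfolding power2_eq_square
    using assms by (intro mult_mono mult_right_mono mult_left_mono) auto
  ultimately have "u * f v \<le> f u * (v - \<beta> * (v - u)\<^sup>2 * u)"
    by (simp add: algebra_simps)
  also have "v - \<beta> * (v - u)\<^sup>2 * u = u * (v / u - \<beta> * (v - u)\<^sup>2)"
    using uv by (simp add: field_simps)
  finally have "u * f v \<le> u * (f u * (v / u - \<beta> * (v - u)\<^sup>2))"
    by (simp only: ac_simps)
  then have "f v \<le> f u * (v / u - \<beta> * (v - u)\<^sup>2)"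
    using uv by simp
  then show ?thesis
    using f by (simp add: pos_divide_le_eq ac_simps)
qed

text \<open>The slope bound is available only at \<open>w\<close>. It is first carried back to the
  secant slope \<open>s\<close> over \<open>[v, w]\<close>, giving \<open>s \<ge> - f v / v\<close>;
  concavity at \<open>u < v < w\<close> then limits how far \<open>f\<close> can drop from
  \<open>u\<close> to \<open>v\<close>.\<close>

lemma decreasing_ratio_bound:
  assumes conc: "alpha_concave_on (\<beta> * \<gamma>) 0 d f" and "\<beta> > 0"
    and uv: "0 < u" "u < v" "v < w" "w \<le> d" and f: "0 < f v" "f v \<le> \<gamma>"
    and D: "(f has_real_derivative D) (at_left w)" "\<bar>D\<bar> < f w / w"
  shows "f u / f v \<le> v / u - \<beta> * (v - u)\<^sup>2"
proof -
  define s where "s = (f w - f v) / (w - v)"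
  have "D * (w - v) \<le> f w - f v"
    by (rule left_derivative_le_secant_slope[OF conc _ _ _ D(1)]) (use uv in auto)
  moreover have "- (f w / w) * (w - v) \<le> D * (w - v)"
    using D uv by (intro mult_right_mono) auto
  ultimately have "- (f w / w) * (w - v) \<le> f w - f v"
    by linarith
  then have A: "w * f v \<le> f w * (2 * w - v)"
    using uv by (simp add: field_simps)
  \<comment> \<open>\<open>A\<close> bounds \<open>f w\<close> below by
    \<open>w * f v / (2 * w - v)\<close>. This comparison shows that bound to be at least
    \<open>f v * (2 * v - w) / v\<close>, which is what the estimate of \<open>s\<close>
    requires.\<close>
  have "(2 * w - v) * (f v * (2 * v - w)) \<le> f v * (v * w)"
  proof -
    have "(2 * w - v) * (2 * v - w) = v * w - 2 * (w - v)\<^sup>2"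
      by (simp add: power2_eq_square algebra_simps)
    also have "\<dots> \<le> v * w"
      by simp
    finally have "f v * ((2 * w - v) * (2 * v - w)) \<le> f v * (v * w)"
      using f by (intro mult_left_mono) auto
    then show ?thesis
      by (simp only: ac_simps)
  qed
  also have "\<dots> \<le> v * (f w * (2 * w - v))"
    using mult_left_mono[OF A, of v] uv by (simp add: ac_simps)
  finally have "(2 * w - v) * (f v * (2 * v - w)) \<le> (2 * w - v) * (v * f w)"
    by (simp add: ac_simps)
  then have "f v * (2 * v - w) \<le> v * f w"
    using uv by (simp add: mult_le_cancel_left)
  then have s: "- (f v / v) \<le> s"
    using uv by (simp add: s_def field_simps)
  have \<gamma>: "0 < \<gamma>"
    using f by simp
  have fw: "f w = f v + s * (w - v)"
    using uv by (simp add: s_def)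
  have "(w - v) * f u + (v - u) * f w + \<beta> * \<gamma> * ((w - u) * (w - v) * (v - u)) \<le> (w - u) * f v"
    by (rule alpha_concave_on_three_points[OF conc]) (use uv in auto)
  then have "(w - v) * (f u + (v - u) * s + \<beta> * \<gamma> * ((w - u) * (v - u))) \<le> (w - v) * f v"
    unfolding fw by (simp add: algebra_simps)
  then have "f u + (v - u) * s + \<beta> * \<gamma> * ((w - u) * (v - u)) \<le> f v"
    using uv by simp
  moreover have "(v - u) * - (f v / v) \<le> (v - u) * s"
    using s uv by (intro mult_left_mono) auto
  moreover have "f v * (\<beta> * (v - u)\<^sup>2) \<le> \<gamma> * (\<beta> * ((w - u) * (v - u)))"
    unfolding power2_eq_square
    using assms \<gamma> by (intro mult_mono mult_right_mono mult_left_mono) auto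
  ultimately have "f u \<le> f v + (v - u) * (f v / v) - f v * (\<beta> * (v - u)\<^sup>2)"
    by (simp add: algebra_simps)
  also have "\<dots> = f v * (1 + (v - u) / v - \<beta> * (v - u)\<^sup>2)"
    by (simp add: algebra_simps)
  \<comment> \<open>Here \<open>1 + (v - u) / v = 2 - u / v\<close>, so the inequality is
    \<open>u / v + v / u \<ge> 2\<close>.\<close>
  also have "\<dots> \<le> f v * (v / u - \<beta> * (v - u)\<^sup>2)"
  proof -
    have "(v / u - (1 + (v - u) / v)) = (v - u)\<^sup>2 / (u * v)"
      using uv by (simp add: field_simps power2_eq_square)
    also have "\<dots> \<ge> 0"
      using uv by simp
    finally show ?thesis
      using f by (intro mult_left_mono) auto
  qed
  finally show ?thesis
    using f by (simp add: pos_divide_le_eq ac_simps)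
qed

text \<open>For positive arguments this is the exponential of the distance between
  \<open>ln u\<close> and \<open>ln v\<close>. Its symmetry removes the need to track which orbit is
  ahead.\<close>

definition mutual_ratio :: "real \<Rightarrow> real \<Rightarrow> real" where
  "mutual_ratio u v = max (u / v) (v / u)"

lemma mutual_ratio_commute: "mutual_ratio u v = mutual_ratio v u"
  by (simp add: mutual_ratio_def max.commute)

lemma mutual_ratio_nonneg: "0 \<le> u \<Longrightarrow> 0 \<le> v \<Longrightarrow> 0 \<le> mutual_ratio u v"
  by (simp add: mutual_ratio_def le_max_iff_disj)

text \<open>Since \<open>f\<close> may swap the order of the two points, both quotients of the
  images have to be bounded.\<close>

lemma mutual_ratio_decrease:
  assumes conc: "alpha_concave_on (\<beta> * \<gamma>) 0 a f" and pos: "\<beta> > 0" "\<gamma> > 0" "a > 0"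
    and f: "f 0 = 0" "\<And>x. x \<in> {0<..<a} \<Longrightarrow> f x > 0" "\<And>x. x \<in> {0..a} \<Longrightarrow> f x \<le> \<gamma>"
    and uv: "0 < u" "0 < v" "u < a" "v < a"
      "u < isoclinic_point a f" "v < isoclinic_point a f"
  shows "mutual_ratio (f u) (f v) \<le> mutual_ratio u v - \<beta> * (u - v)\<^sup>2"
  using uv
proof (induction u v rule: linorder_wlog)
  case (sym u v)
  then show ?case
    by (metis mutual_ratio_commute power2_commute)
next
  case (le u v)
  have *: "f u > 0" "f v > 0" "f u \<le> \<gamma>" "f v \<le> \<gamma>"
    using le f by auto
  show ?case
  proof (cases "u = v")
    case True
    then show ?thesis
      using le * by (simp add: mutual_ratio_def)
  next
    case False
    with le have "u < v" by simp
    then have "u / v \<le> 1" "1 \<le> v / u"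
      using le by auto
    then have "mutual_ratio u v = v / u"
      by (simp add: mutual_ratio_def)
    moreover have inc: "f v / f u \<le> v / u - \<beta> * (v - u)\<^sup>2"
      using increasing_ratio_bound[OF conc] le \<open>u < v\<close> * f pos by auto
    moreover have "f u / f v \<le> v / u - \<beta> * (v - u)\<^sup>2"
    proof (rule isoclinic_pointE[OF conc _ \<open>a > 0\<close> f(1,2) \<open>v < isoclinic_point a f\<close>])
      show "0 < \<beta> * \<gamma>"
        using pos by simp
    next
      \<comment> \<open>For monotone \<open>f\<close> the isoclinic point is \<open>a\<close> by
        convention and gives no slope bound. None is needed: the reversed quotient is at most
        \<open>1\<close>, hence at most the quotient bounded in \<open>inc\<close>.\<close>
      assume "mono_on {0..a} f"
      then have "f u \<le> f v"
        using le by (auto intro: mono_onD)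
      then have "f u / f v \<le> 1" "1 \<le> f v / f u"
        using * by auto
      then show ?thesis
        using inc by linarith
    next
      fix w D
      assume "v < w" "w \<le> a" "(f has_real_derivative D) (at_left w)" "\<bar>D\<bar> < f w / w"
      then show ?thesis
        using decreasing_ratio_bound[OF conc] le \<open>u < v\<close> * pos by auto
    qed auto
    ultimately show ?thesis
      by (simp add: mutual_ratio_def power2_commute)
  qed
qed

section \<open>Positivity and convergence of the orbits\<close>

lemma isoclinic_point_le:
  assumes "alpha_concave_on \<alpha> 0 a f" "\<alpha> > 0" "a > 0" "f 0 = 0"
    and "\<And>x. x \<in> {0<..<a} \<Longrightarrow> f x > 0" and "v < isoclinic_point a f"
  shows "v < a"
  by (rule isoclinic_pointE[OF assms]) auto

text \<open>At the points \<open>0\<close>, \<open>x\<close>, \<open>a\<close> the three-point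
  inequality has the strict gain \<open>\<alpha> * (a * (a - x) * x)\<close>, so \<open>f x\<close>
  is positive even when \<open>f a = 0\<close>.\<close>

lemma alpha_concave_on_pos:
  assumes "alpha_concave_on \<alpha> 0 a f" "\<alpha> > 0" "f 0 = 0" "f a \<ge> 0" "0 < x" "x < a"
  shows "f x > 0"
proof -
  have "0 < x * f a + \<alpha> * (a * (a - x) * x)"
    using assms by (intro add_nonneg_pos mult_nonneg_nonneg mult_pos_pos) auto
  also have "\<dots> \<le> a * f x"
    using alpha_concave_on_three_points[OF assms(1), of 0 x a] assms by simp
  finally show ?thesis
    using assms by (simp add: zero_less_mult_iff)
qed

theorem theorem5p3:
  fixes a :: real and f :: "nat \<Rightarrow> real \<Rightarrow> real" and b x y :: "nat \<Rightarrow> real"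
  assumes "a > 0"
    and "\<And>n. n \<ge> 1 \<Longrightarrow> f n \<in> {0..a} \<rightarrow> {0..a}"
    and "\<And>n. n \<ge> 1 \<Longrightarrow> f n 0 = 0"
    and "pinched a f \<or> equiconcave a f"
    and "\<And>n. n \<ge> 1 \<Longrightarrow> b n = isoclinic_point a (f n)"
    and "x 0 \<in> {0<..a}" and "\<And>n. n \<ge> 1 \<Longrightarrow> x n = f n (x (n - 1))"
    and "y 0 \<in> {0<..a}" and "\<And>n. n \<ge> 1 \<Longrightarrow> y n = f n (y (n - 1))"
    and "\<And>n. n \<ge> 1 \<Longrightarrow> x (n - 1) < b n \<and> y (n - 1) < b n"
  shows "(\<lambda>n. \<bar>x n - y n\<bar>) \<longlonglongrightarrow> 0"
proof -
  have x_Suc: "x (Suc n) = f (Suc n) (x n)" and y_Suc: "y (Suc n) = f (Suc n) (y n)" for n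
    using assms(7,9)[of "Suc n"] by auto
  have f_range: "f (Suc n) t \<in> {0..a}" if "t \<in> {0..a}" for n t
    using assms(2)[of "Suc n"] that by auto
  have range: "x n \<in> {0..a}" "y n \<in> {0..a}" for n
    by (induction n) (use assms(6,8) f_range in \<open>auto simp: x_Suc y_Suc\<close>)
  show ?thesis
  proof (cases "pinched a f")
    case True
    then obtain m where "m \<ge> 1" and m: "\<forall>t\<in>{0..a}. f m t = 0"
      by (auto simp: pinched_def)
    \<comment> \<open>\<open>x m\<close> and \<open>y m\<close> are already values of the vanishing
      map \<open>f m\<close>, and all later maps fix \<open>0\<close>.\<close>
    have "x n = 0 \<and> y n = 0" if "n \<ge> m" for n
      using that
    proof (induction rule: dec_induct)
      case base
      then show ?case
        using assms(7,9)[OF \<open>m \<ge> 1\<close>] m range by auto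
    next
      case (step n)
      then show ?case
        using assms(3)[of "Suc n"] by (simp add: x_Suc y_Suc)
    qed
    then have "eventually (\<lambda>n. \<bar>x n - y n\<bar> = 0) sequentially"
      by (intro eventually_sequentiallyI[of m]) auto
    then show ?thesis
      by (rule tendsto_eventually)
  next
    case False
    \<comment> \<open>The index is shifted: \<open>\<gamma> n\<close> belongs to
      \<open>f (Suc n)\<close>, the map leading from \<open>x n\<close> to
      \<open>x (Suc n)\<close>.\<close>
    define \<gamma> where "\<gamma> n = (SUP t\<in>{0..a}. f (Suc n) t)" for n
    from False obtain \<beta> where "\<beta> > 0"
      and conc: "\<And>n. alpha_concave_on (\<beta> * \<gamma> n) 0 a (f (Suc n))"
      using assms(4) by (auto simp: equiconcave_def \<gamma>_def)
    have f_le: "f (Suc n) t \<le> \<gamma> n" if "t \<in> {0..a}" for n t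
      unfolding \<gamma>_def
      by (rule cSUP_upper) (use f_range that in \<open>auto intro!: bdd_aboveI[of _ a]\<close>)
    have \<gamma>_pos: "\<gamma> n > 0" for n
    proof -
      obtain t where t: "t \<in> {0..a}" "f (Suc n) t \<noteq> 0"
        using False by (force simp: pinched_def)
      then show ?thesis
        using f_le[OF t(1), of n] f_range[OF t(1), of n] by auto
    qed
    have f0: "f (Suc n) 0 = 0" for n
      using assms(3)[of "Suc n"] by simp
    have f_pos: "f (Suc n) t > 0" if "t \<in> {0<..<a}" for n t
      using alpha_concave_on_pos[OF conc[of n], of t] that f_range[of a n] f0 \<gamma>_pos[of n] \<open>\<beta> > 0\<close>
      by auto
    have iso: "x n < isoclinic_point a (f (Suc n))" "y n < isoclinic_point a (f (Suc n))" for n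
      using assms(5,10)[of "Suc n"] by auto
    \<comment> \<open>The endpoint must be excluded before positivity can be propagated along the
      orbits, because \<open>f (Suc n) a\<close> may be \<open>0\<close>.\<close>
    have less_a: "x n < a" "y n < a" for n
      using isoclinic_point_le[OF conc _ \<open>a > 0\<close> f0 f_pos] iso \<open>\<beta> > 0\<close> \<gamma>_pos
      by (meson mult_pos_pos)+
    have pos: "x n > 0" "y n > 0" for n
      by (induction n) (use assms(6,8) less_a f_pos in \<open>auto simp: x_Suc y_Suc\<close>)
    define R where "R n = mutual_ratio (x n) (y n)" for n
    have step: "\<beta> * (x n - y n)\<^sup>2 \<le> R n - R (Suc n)" for n
      using mutual_ratio_decrease[OF conc \<open>\<beta> > 0\<close> \<gamma>_pos \<open>a > 0\<close> f0 f_pos f_le pos less_a iso]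
      by (simp add: R_def x_Suc y_Suc algebra_simps)
    have "0 \<le> \<beta> * (x n - y n)\<^sup>2" for n
      using \<open>\<beta> > 0\<close> by simp
    then have "R (Suc n) \<le> R n" for n
      using step by (meson diff_ge_0_iff_ge order_trans)
    then have "decseq R"
      by (rule decseq_SucI)
    moreover have "0 \<le> R n" for n
      using pos[of n] by (simp add: R_def mutual_ratio_nonneg)
    ultimately obtain L where L: "R \<longlonglongrightarrow> L"
      using decseq_convergent[of R 0] by blast
    have "(\<lambda>n. R n - R (Suc n)) \<longlonglongrightarrow> L - L"
      using L LIMSEQ_Suc[OF L] by (rule tendsto_diff)
    then have "(\<lambda>n. R n - R (Suc n)) \<longlonglongrightarrow> 0"
      by simp
    then have "(\<lambda>n. \<beta> * (x n - y n)\<^sup>2) \<longlonglongrightarrow> 0"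
      by (rule tendsto_sandwich[OF _ _ tendsto_const, rotated 2])
        (use step \<open>\<beta> > 0\<close> in auto)
    then have "(\<lambda>n. inverse \<beta> * (\<beta> * (x n - y n)\<^sup>2)) \<longlonglongrightarrow> 0"
      by (rule tendsto_mult_right_zero)
    then have "(\<lambda>n. (x n - y n)\<^sup>2) \<longlonglongrightarrow> 0"
      using \<open>\<beta> > 0\<close> by (simp add: field_simps)
    then show ?thesis
      using tendsto_real_sqrt by fastforce
  qed
qed

end
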